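(* Let $u_1,\dots,u_g$ be functions of $t=(t_1=x,\dots,t_g)$ whose generating function $\mathbf u(\xi)=\sum_{i=1}^gu_i\xi^i$ satisfies $$\mathbf u'''(\xi)+2u_1'(2-\mathbf u(\xi))-4(\xi^{-1}+u_1)\mathbf u'(\xi)=0,$$ $$\partial_k\mathbf u(\xi)=D_k(2-\mathbf u(\xi))\,\mathbf u'(\xi)-D_k(\mathbf u'(\xi))\,(2-\mathbf u(\xi)),\quad 1\le k\le g,$$ and let $\mu_1,\dots,\mu_{2g}$ be the constants defined by $$4\Bigl(4\xi^{-1}+\sum_{i=1}^{2g}\mu_i\xi^i\Bigr)=\mathbf u'(\xi)^2+2\mathbf u''(\xi)(2-\mathbf u(\xi))+4(\xi^{-1}+u_1)(2-\mathbf u(\xi))^2.$$ Then the operators $\mathcal L,\mathcal U_1,\dots,\mathcal U_g$ satisfy the algebraic relation $$4\bigl(\mathcal U_1\mathcal L^{g-1}+\mathcal U_2\mathcal L^{g-2}+\dots+\mathcal U_{g-1}\mathcal L+\mathcal U_g\bigr)^2=4\mathcal L^{2g+1}+\mu_1\mathcal L^{2g-1}+\mu_2\mathcal L^{2g-2}+\dots+\mu_{2g}.$$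
   Context: Prime denotes $\partial_x=\partial/\partial t_1$; $\partial_i=\partial/\partial t_i$ for $1\le i\le g$ and $\partial_{g+1}:=0$. $\mathcal L=\partial_x^2-u_1$ and $\mathcal U_i=\partial_x^2\partial_i-\frac12(u_1\partial_i+\partial_iu_1)-\frac14(u_i\partial_x+\partial_xu_i)-\partial_{i+1}$, where functions denote multiplication operators and products are compositions of operators. For a polynomial $f(\xi)=\sum_{j\ge0}f_j\xi^j$, $(D_kf)(\xi)=\frac12\sum_{j=0}^{k-1}f_j\xi^{j-k+1}$. Derivatives of $\mathbf u(\xi)$ are taken coefficientwise. Under the two displayed equations for $\mathbf u$, the operators $\mathcal L,\mathcal U_1,\dots,\mathcal U_g$ commute, and the coefficients $\mu_i$ are independent of $t$. *)

theory Defs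
  imports
    "HOL-Analysis.Analysis"
    "HOL-Computational_Algebra.Formal_Laurent_Series"
    "HOL-Library.Function_Algebras"
begin

text \<open>
  The scalars are an arbitrary \<open>'k :: real_normed_field\<close>, so that real variables (smooth functions)
  and complex variables (holomorphic functions) are treated alike. A point \<open>t\<close> has type \<open>'k ^ 'n\<close>,
  and a bijection \<open>e\<close> from \<open>{1..g}\<close> onto \<open>'n\<close> names its coordinates: \<open>t\<^sub>i = t $ e i\<close>.
\<close>

definition coord_deriv :: "'n::finite \<Rightarrow> ('k::real_normed_field ^ 'n \<Rightarrow> 'k) \<Rightarrow> 'k ^ 'n \<Rightarrow> 'k" where
  "coord_deriv j f t = deriv (\<lambda>z. f (\<chi> m. if m = j then z else t $ m)) (t $ j)"

text \<open>
  All iterated partial derivatives exist and are continuous: this is \<open>C\<^sup>\<infinity>\<close> over the reals and, by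
  Osgood's lemma, holomorphy over the complex numbers. Functions are total; only their values on
  the open set \<open>S\<close> matter.
\<close>

definition smooth_on :: "('k::real_normed_field ^ 'n::finite) set \<Rightarrow> ('k ^ 'n \<Rightarrow> 'k) \<Rightarrow> bool" where
  "smooth_on S f \<longleftrightarrow> (\<forall>js. let h = foldr coord_deriv js f in
     continuous_on S h \<and>
     (\<forall>t\<in>S. \<forall>j. (\<lambda>z. h (\<chi> m. if m = j then z else t $ m)) field_differentiable at (t $ j)))"

text \<open>
  Operators are maps on functions; \<open>+\<close>, \<open>-\<close>, \<open>0\<close> and finite sums of operators are pointwise,
  \<open>\<circ>\<close> is the operator product and \<open>^^\<close> its power. Note that \<open>\<circ>\<close>
  binds less tightly than \<open>+\<close> and \<open>-\<close>.
\<close>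

type_synonym ('k, 'n) oper = "('k ^ 'n \<Rightarrow> 'k) \<Rightarrow> 'k ^ 'n \<Rightarrow> 'k"

definition mult_op :: "('k ^ 'n \<Rightarrow> 'k) \<Rightarrow> ('k::real_normed_field, 'n::finite) oper" where
  "mult_op h = (\<lambda>f t. h t * f t)"

definition const_op :: "'k \<Rightarrow> ('k::real_normed_field, 'n::finite) oper" where
  "const_op c = mult_op (\<lambda>t. c)"

text \<open>The second case provides the convention \<open>\<partial>\<^sub>g\<^sub>+\<^sub>1 = 0\<close>.\<close>

definition pd :: "nat \<Rightarrow> (nat \<Rightarrow> 'n) \<Rightarrow> nat \<Rightarrow> ('k::real_normed_field, 'n::finite) oper" where
  "pd g e i = (if i \<in> {1..g} then coord_deriv (e i) else 0)"

definition L_op ::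
  "nat \<Rightarrow> (nat \<Rightarrow> 'n) \<Rightarrow> (nat \<Rightarrow> 'k ^ 'n \<Rightarrow> 'k) \<Rightarrow> ('k::real_normed_field, 'n::finite) oper" where
  "L_op g e u = pd g e 1 ^^ 2 - mult_op (u 1)"

definition U_op ::
  "nat \<Rightarrow> (nat \<Rightarrow> 'n) \<Rightarrow> (nat \<Rightarrow> 'k ^ 'n \<Rightarrow> 'k) \<Rightarrow> nat
     \<Rightarrow> ('k::real_normed_field, 'n::finite) oper" where
  "U_op g e u i =
     (pd g e 1 ^^ 2 \<circ> pd g e i)
     - (const_op (1/2) \<circ> ((mult_op (u 1) \<circ> pd g e i) + (pd g e i \<circ> mult_op (u 1))))
     - (const_op (1/4) \<circ> ((mult_op (u i) \<circ> pd g e 1) + (pd g e 1 \<circ> mult_op (u i))))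
     - pd g e (Suc i)"

text \<open>
  Identities in \<open>\<xi>\<close> involve \<open>\<xi>\<^sup>-\<^sup>1\<close> and are identities of formal Laurent series with \<open>\<xi>\<close> = \<open>fls_X\<close>.
  Coefficientwise derivatives of a generating function are \<open>gen g\<close> of the derivatives of
  its coefficients.
\<close>

definition gen :: "nat \<Rightarrow> (nat \<Rightarrow> 'p \<Rightarrow> 'k) \<Rightarrow> 'p \<Rightarrow> 'k::field fls" where
  "gen g v t = (\<Sum>i=1..g. fls_const (v i t) * fls_X ^ i)"

definition D_trunc :: "nat \<Rightarrow> 'k::field fls \<Rightarrow> 'k fls" where
  "D_trunc k f =
     fls_const (1/2) * (\<Sum>j<k. fls_const (fls_nth f (int j)) * fls_X_intpow (int j - int k + 1))"

end

theory Submission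
  imports Defs
begin

text \<open>
  Write \<open>v = 2 - \<uu>(\<xi>) = \<Sum> v\<^sub>i \<xi>\<^sup>i\<close>. Mixed partial derivatives commute and the flows give
  \<open>\<partial>\<^sub>i u\<^sub>1 = u\<^sub>i'\<close>, so \<open>U\<^sub>i = \<partial>\<^sub>i L - \<partial>\<^sub>i\<^sub>+\<^sub>1 + A\<^sub>i\<close> with \<open>A\<^sub>i = v\<^sub>i \<partial>\<^sub>x / 2 - v\<^sub>i' / 4\<close>, and
  \<open>W = \<Sum> U\<^sub>i L\<^sup>g\<^sup>-\<^sup>i\<close> telescopes to \<open>\<Sum> A\<^sub>i L\<^sup>g\<^sup>-\<^sup>i\<close> over \<open>0 \<le> i \<le> g\<close>, an ordinary differential operator in
  \<open>x\<close>. The stationary equation says \<open>[L, A\<^sub>i] = v\<^sub>i' L - v\<^sub>i\<^sub>+\<^sub>1'\<close>; a second telescoping sum shows that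
  \<open>W\<close> commutes with \<open>L\<close>. Hence \<open>W\<^sup>2 = \<Sum> A\<^sub>i A\<^sub>k L\<^sup>2\<^sup>g\<^sup>-\<^sup>i\<^sup>-\<^sup>k\<close>. In this sum the first-order parts of
  \<open>A\<^sub>i A\<^sub>k\<close> cancel by symmetry, and the remaining coefficients are those of the equation defining
  the \<open>\<mu>\<^sub>i\<close>.
\<close>

section \<open>Partial derivatives and closure properties of smooth functions\<close>

no_notation fps_nth (infixl "$" 75)

definition upd :: "'n \<Rightarrow> 'k ^ 'n \<Rightarrow> 'k \<Rightarrow> 'k ^ 'n::finite" where
  "upd j t z = (\<chi> m. if m = j then z else t $ m)"

definition partial_diff :: "'n::finite \<Rightarrow> ('k::real_normed_field ^ 'n \<Rightarrow> 'k) \<Rightarrow> 'k ^ 'n \<Rightarrow> bool" where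
  "partial_diff j f t \<longleftrightarrow> (\<lambda>z. f (upd j t z)) field_differentiable at (t $ j)"

lemma upd_self [simp]: "upd j t (t $ j) = t"
  and upd_upd [simp]: "upd j (upd j t z) w = upd j t w"
  and upd_nth [simp]: "upd j t z $ j = z"
  and upd_commute: "i \<noteq> j \<Longrightarrow> upd i (upd j t z) w = upd j (upd i t w) z"
  by (auto simp: upd_def vec_eq_iff)

lemma tendsto_upd [tendsto_intros]:
  fixes t :: "'b \<Rightarrow> 'k::topological_space ^ 'n::finite"
  assumes "(t \<longlongrightarrow> s) F" "(z \<longlongrightarrow> w) F"
  shows "((\<lambda>x. upd j (t x) (z x)) \<longlongrightarrow> upd j s w) F"
  unfolding upd_def
proof (rule vec_tendstoI)
  fix i
  have "((\<lambda>x. t x $ i) \<longlongrightarrow> s $ i) F" using assms(1) by (rule tendsto_vec_nth)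
  then show "((\<lambda>x. (\<chi> m. if m = j then z x else t x $ m) $ i)
      \<longlongrightarrow> (\<chi> m. if m = j then w else s $ m) $ i) F"
    using assms(2) by simp
qed

lemma coord_deriv_eq: "coord_deriv j f t = deriv (\<lambda>z. f (upd j t z)) (t $ j)"
  by (simp add: coord_deriv_def upd_def)

lemma coord_derivI:
  "((\<lambda>z. f (upd j t z)) has_field_derivative d) (at (t $ j)) \<Longrightarrow> coord_deriv j f t = d"
  by (simp add: coord_deriv_eq DERIV_imp_deriv)

lemma partial_diffI: "((\<lambda>z. f (upd j t z)) has_field_derivative d) (at (t $ j)) \<Longrightarrow> partial_diff j f t"
  unfolding partial_diff_def field_differentiable_def by blast

lemma partial_diffD:
  "partial_diff j f t \<Longrightarrow> ((\<lambda>z. f (upd j t z)) has_field_derivative coord_deriv j f t) (at (t $ j))"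
  unfolding partial_diff_def field_differentiable_def coord_deriv_eq using DERIV_imp_deriv by blast

lemma eventually_upd_in:
  fixes t :: "'k::real_normed_field ^ 'n::finite"
  assumes "open S" "t \<in> S"
  shows "\<forall>\<^sub>F z in nhds (t $ j). upd j t z \<in> S"
proof -
  have "((\<lambda>z. upd j t z) \<longlongrightarrow> upd j t (t $ j)) (nhds (t $ j))"
    by (intro tendsto_intros filterlim_ident)
  then show ?thesis using assms by (auto dest: topological_tendstoD)
qed

lemma partial_diff_cong:
  assumes "open S" "t \<in> S" "\<And>s. s \<in> S \<Longrightarrow> f s = h s" "partial_diff j f t"
  shows "partial_diff j h t" and "coord_deriv j h t = coord_deriv j f t"
proof -
  have ev: "\<forall>\<^sub>F z in nhds (t $ j). f (upd j t z) = h (upd j t z)"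
    using eventually_upd_in[OF assms(1,2)] by eventually_elim (use assms(3) in auto)
  have "((\<lambda>z. h (upd j t z)) has_field_derivative coord_deriv j f t) (at (t $ j))"
    using partial_diffD[OF assms(4)] DERIV_cong_ev[OF refl ev refl] by blast
  then show "partial_diff j h t" "coord_deriv j h t = coord_deriv j f t"
    by (blast intro: partial_diffI coord_derivI)+
qed

text \<open>\<open>smooth_on\<close> quantifies over lists of directions, which is awkward for
  products. Bounding the order instead permits induction on \<open>n\<close>: a derivative of a
  product is a sum of products of lower order.\<close>

primrec Ck_on :: "nat \<Rightarrow> ('k::real_normed_field ^ 'n::finite) set \<Rightarrow> ('k ^ 'n \<Rightarrow> 'k) \<Rightarrow> bool" where
  "Ck_on 0 S f = continuous_on S f"
| "Ck_on (Suc n) S f = (continuous_on S f \<and> (\<forall>t\<in>S. \<forall>j. partial_diff j f t) \<and> (\<forall>j. Ck_on n S (coord_deriv j f)))"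

lemma smooth_on_alt:
  "smooth_on S f \<longleftrightarrow> (\<forall>js. continuous_on S (foldr coord_deriv js f) \<and>
     (\<forall>t\<in>S. \<forall>j. partial_diff j (foldr coord_deriv js f) t))"
  by (simp add: smooth_on_def Let_def partial_diff_def upd_def)

lemma smooth_on_coord_deriv: "smooth_on S f \<Longrightarrow> smooth_on S (coord_deriv j f)"
  unfolding smooth_on_alt using foldr_append[of coord_deriv _ "[j]" f] by (metis foldr.simps id_apply o_apply)

lemma smooth_on_continuous: "smooth_on S f \<Longrightarrow> continuous_on S f"
  unfolding smooth_on_alt by (metis foldr_Nil id_apply)

lemma smooth_on_partial_diff: "smooth_on S f \<Longrightarrow> t \<in> S \<Longrightarrow> partial_diff j f t"
  unfolding smooth_on_alt by (metis foldr_Nil id_apply)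

lemma smooth_on_iff_Ck_on: "smooth_on S f \<longleftrightarrow> (\<forall>n. Ck_on n S f)"
proof
  show "smooth_on S f \<Longrightarrow> \<forall>n. Ck_on n S f"
  proof
    fix n assume "smooth_on S f"
    then show "Ck_on n S f"
      by (induction n arbitrary: f)
        (auto simp: smooth_on_continuous smooth_on_partial_diff smooth_on_coord_deriv)
  qed
next
  assume *: "\<forall>n. Ck_on n S f"
  have "\<forall>n. Ck_on n S (foldr coord_deriv js f)" for js
  proof (induction js)
    case (Cons j js)
    then have "Ck_on (Suc n) S (foldr coord_deriv js f)" for n by blast
    then show ?case by simp
  qed (use * in simp)
  then have "Ck_on (Suc 0) S (foldr coord_deriv js f)" for js by blast
  then show "smooth_on S f" by (simp add: smooth_on_alt)
qed

lemma Ck_on_SucD: "Ck_on (Suc n) S f \<Longrightarrow> Ck_on n S f"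
  by (induction n arbitrary: f) auto

text \<open>Functions are total, but formulas such as the Leibniz rule hold on \<open>S\<close>
  only. Since \<open>S\<close> is open, a derivative at a point of \<open>S\<close> sees nothing
  outside \<open>S\<close>.\<close>

lemma Ck_on_cong:
  "open S \<Longrightarrow> Ck_on n S f \<Longrightarrow> (\<And>s. s \<in> S \<Longrightarrow> f s = h s) \<Longrightarrow> Ck_on n S h"
proof (induction n arbitrary: f h)
  case 0
  then show ?case using continuous_on_cong by force
next
  case (Suc n)
  have "continuous_on S h" using Suc.prems continuous_on_cong by force
  moreover have "partial_diff j h t" if "t \<in> S" for t j
    using partial_diff_cong(1)[of S t f h j] Suc.prems that by auto
  moreover have "Ck_on n S (coord_deriv j h)" for j
  proof (rule Suc.IH)
    show "Ck_on n S (coord_deriv j f)" using Suc.prems by simp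
    show "coord_deriv j f s = coord_deriv j h s" if "s \<in> S" for s
      using partial_diff_cong(2)[of S s f h j] Suc.prems that by auto
  qed (use Suc.prems in auto)
  ultimately show ?case by simp
qed

lemma Ck_on_const: "Ck_on n S (\<lambda>_. c)"
proof (induction n arbitrary: c)
  case (Suc n)
  have "coord_deriv j (\<lambda>_. c) = (\<lambda>_. 0 :: 'a)" for j :: 'b
    by (intro ext coord_derivI) simp
  then show ?case using Suc by (auto intro!: partial_diffI[where d = 0])
qed simp

lemma Ck_on_add:
  "open S \<Longrightarrow> Ck_on n S f \<Longrightarrow> Ck_on n S h \<Longrightarrow> Ck_on n S (\<lambda>t. f t + h t)"
proof (induction n arbitrary: f h)
  case (Suc n)
  have d: "((\<lambda>z. f (upd j t z) + h (upd j t z)) has_field_derivative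
      coord_deriv j f t + coord_deriv j h t) (at (t $ j))" if "t \<in> S" for t j
    using Suc.prems that by (intro DERIV_add partial_diffD) auto
  have "Ck_on n S (coord_deriv j (\<lambda>t. f t + h t))" for j
  proof (rule Ck_on_cong[OF \<open>open S\<close>])
    show "Ck_on n S (\<lambda>t. coord_deriv j f t + coord_deriv j h t)"
      using Suc by auto
  qed (use coord_derivI[OF d] in simp)
  then show ?case using Suc.prems by (auto intro!: continuous_intros partial_diffI[OF d])
qed (auto intro: continuous_intros)

lemma Ck_on_mult:
  "open S \<Longrightarrow> Ck_on n S f \<Longrightarrow> Ck_on n S h \<Longrightarrow> Ck_on n S (\<lambda>t. f t * h t)"
proof (induction n arbitrary: f h)
  case (Suc n)
  have d: "((\<lambda>z. f (upd j t z) * h (upd j t z)) has_field_derivative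
      coord_deriv j f t * h t + coord_deriv j h t * f t) (at (t $ j))" if "t \<in> S" for t j
    using Suc.prems that DERIV_mult[OF partial_diffD[of j f t] partial_diffD[of j h t]] by auto
  have "Ck_on n S (coord_deriv j (\<lambda>t. f t * h t))" for j
  proof (rule Ck_on_cong[OF \<open>open S\<close>])
    \<comment> \<open>Each product pairs a derivative of order \<open>n\<close> with a factor of
      order \<open>Suc n\<close>, whence \<open>Ck_on_SucD\<close>.\<close>
    show "Ck_on n S (\<lambda>t. coord_deriv j f t * h t + coord_deriv j h t * f t)"
      using Suc.prems Ck_on_SucD by (intro Ck_on_add Suc.IH) auto
  qed (use coord_derivI[OF d] in simp)
  then show ?case using Suc.prems by (auto intro!: continuous_intros partial_diffI[OF d])
qed (auto intro: continuous_intros)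

lemma smooth_on_cong:
  "open S \<Longrightarrow> smooth_on S f \<Longrightarrow> (\<And>s. s \<in> S \<Longrightarrow> f s = h s) \<Longrightarrow> smooth_on S h"
  unfolding smooth_on_iff_Ck_on by (blast intro: Ck_on_cong)

lemma smooth_on_const: "smooth_on S (\<lambda>_. c)"
  by (simp add: smooth_on_iff_Ck_on Ck_on_const)

lemma smooth_on_add:
  "open S \<Longrightarrow> smooth_on S f \<Longrightarrow> smooth_on S h \<Longrightarrow> smooth_on S (\<lambda>t. f t + h t)"
  by (simp add: smooth_on_iff_Ck_on Ck_on_add)

lemma smooth_on_mult:
  "open S \<Longrightarrow> smooth_on S f \<Longrightarrow> smooth_on S h \<Longrightarrow> smooth_on S (\<lambda>t. f t * h t)"
  by (simp add: smooth_on_iff_Ck_on Ck_on_mult)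

lemma smooth_on_uminus: "open S \<Longrightarrow> smooth_on S f \<Longrightarrow> smooth_on S (\<lambda>t. - f t)"
  using smooth_on_mult[OF _ smooth_on_const, of S f "-1"] by simp

lemma smooth_on_diff:
  "open S \<Longrightarrow> smooth_on S f \<Longrightarrow> smooth_on S h \<Longrightarrow> smooth_on S (\<lambda>t. f t - h t)"
  using smooth_on_add[OF _ _ smooth_on_uminus, of S f h] by simp

lemma smooth_on_sum:
  "open S \<Longrightarrow> (\<And>i. i \<in> I \<Longrightarrow> smooth_on S (f i)) \<Longrightarrow> smooth_on S (\<lambda>t. \<Sum>i\<in>I. f i t)"
  by (induction I rule: infinite_finite_induct) (auto intro: smooth_on_const smooth_on_add)

lemmas smooth_on_intros =
  smooth_on_const smooth_on_add smooth_on_mult smooth_on_diff smooth_on_sum smooth_on_coord_deriv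

section \<open>Locality of differentiation and symmetry of mixed partial derivatives\<close>

lemma coord_deriv_cong:
  assumes "open S" "t \<in> S" "\<And>s. s \<in> S \<Longrightarrow> f s = h s"
  shows "coord_deriv j f t = coord_deriv j h t"
  unfolding coord_deriv_eq
  by (rule deriv_cong_ev, use eventually_upd_in[OF assms(1,2)] in eventually_elim) (use assms in auto)

text \<open>The mean value inequality is applied once in each direction. Subtracting the limit value
  \<open>A\<close> beforehand makes the quantity to be bounded the small difference between the
  mixed derivative and \<open>A\<close>. An inequality, unlike a mean value theorem with an
  intermediate point, also serves complex scalars.\<close>

lemma mixed_difference_bound:
  fixes f :: "'k::real_normed_field ^ 'n::finite \<Rightarrow> 'k"
  assumes S: "open S" "t \<in> S" and f: "smooth_on S f" and "i \<noteq> j" and "\<epsilon> > 0"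
  shows "\<forall>\<^sub>F r in at_right 0. norm (f (upd j (upd i t (t $ i + of_real r)) (t $ j + of_real r))
      - f (upd i t (t $ i + of_real r)) - f (upd j t (t $ j + of_real r)) + f t
      - (of_real r)\<^sup>2 * coord_deriv j (coord_deriv i f) t) \<le> \<epsilon> * r\<^sup>2"
proof -
  define A where "A = coord_deriv j (coord_deriv i f) t"
  define P where "P z w = upd j (upd i t z) w" for z w
  have "smooth_on S (coord_deriv j (coord_deriv i f))"
    by (intro smooth_on_coord_deriv f)
  then have "isCont (coord_deriv j (coord_deriv i f)) t"
    using smooth_on_continuous S continuous_on_eq_continuous_at by blast
  then have lim: "(coord_deriv j (coord_deriv i f) \<longlongrightarrow> A) (nhds t)"
    unfolding A_def isCont_def tendsto_at_iff_tendsto_nhds .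
  have ev: "\<forall>\<^sub>F s in nhds t. s \<in> S \<and> norm (coord_deriv j (coord_deriv i f) s - A) < \<epsilon>"
    using tendstoD[OF lim \<open>\<epsilon> > 0\<close>] eventually_nhds_in_open[OF S]
    by eventually_elim (auto simp: dist_norm)
  have "((\<lambda>p. P (fst p) (snd p)) \<longlongrightarrow> P (t $ i) (t $ j)) (nhds (t $ i) \<times>\<^sub>F nhds (t $ j))"
    unfolding P_def by (intro tendsto_intros filterlim_fst filterlim_snd)
  then have "filterlim (\<lambda>p. P (fst p) (snd p)) (nhds t) (nhds (t $ i) \<times>\<^sub>F nhds (t $ j))"
    by (simp add: P_def)
  then have "\<forall>\<^sub>F p in nhds (t $ i) \<times>\<^sub>F nhds (t $ j). P (fst p) (snd p) \<in> S \<and>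
      norm (coord_deriv j (coord_deriv i f) (P (fst p) (snd p)) - A) < \<epsilon>"
    by (rule eventually_compose_filterlim[OF ev])
  \<comment> \<open>A neighbourhood in the product filter contains a box, so the two coordinates can
    be moved independently.\<close>
  then obtain Q R where Q: "eventually Q (nhds (t $ i))" and R: "eventually R (nhds (t $ j))"
    and QR: "\<And>z w. Q z \<Longrightarrow> R w \<Longrightarrow> P z w \<in> S \<and>
      norm (coord_deriv j (coord_deriv i f) (P z w) - A) < \<epsilon>"
    unfolding eventually_prod_filter by auto
  obtain d1 where d1: "d1 > 0" "\<And>z. dist z (t $ i) < d1 \<Longrightarrow> Q z"
    using Q unfolding eventually_nhds_metric by auto
  obtain d2 where d2: "d2 > 0" "\<And>z. dist z (t $ j) < d2 \<Longrightarrow> R z"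
    using R unfolding eventually_nhds_metric by auto
  have "norm (f (upd j (upd i t (t $ i + of_real r)) (t $ j + of_real r))
      - f (upd i t (t $ i + of_real r)) - f (upd j t (t $ j + of_real r)) + f t
      - (of_real r)\<^sup>2 * A) \<le> \<epsilon> * r\<^sup>2" if r: "0 < r" "r < min d1 d2" for r
  proof -
    let ?Z = "cball (t $ i) r" and ?W = "cball (t $ j) r"
    define b where "b = t $ j + of_real r"
    have b: "b \<in> ?W" "t $ j \<in> ?W" and a: "t $ i + of_real r \<in> ?Z" "t $ i \<in> ?Z"
      using r by (auto simp: b_def dist_norm)
    have ZW: "P z w \<in> S" "norm (coord_deriv j (coord_deriv i f) (P z w) - A) \<le> \<epsilon>"
      if "z \<in> ?Z" "w \<in> ?W" for z w
      using QR[OF d1(2) d2(2), of z w] that r by (auto simp: dist_commute less_imp_le)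
    \<comment> \<open>First direction: in \<open>w\<close>, the function has derivative the mixed
      derivative minus \<open>A\<close>, of norm at most \<open>\<epsilon>\<close>.\<close>
    have inner: "norm ((coord_deriv i f (P z b) - b * A) - (coord_deriv i f (P z (t $ j)) - t $ j * A))
        \<le> \<epsilon> * norm (b - t $ j)" if z: "z \<in> ?Z" for z
    proof (rule field_differentiable_bound[of ?W "\<lambda>w. coord_deriv i f (P z w) - w * A"
          "\<lambda>w. coord_deriv j (coord_deriv i f) (P z w) - A"])
      fix w assume w: "w \<in> ?W"
      have "((\<lambda>x. coord_deriv i f (upd j (P z w) x)) has_field_derivative
          coord_deriv j (coord_deriv i f) (P z w)) (at (P z w $ j))"
        using ZW[OF z w] f by (intro partial_diffD smooth_on_partial_diff smooth_on_coord_deriv)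
      then have "((\<lambda>x. coord_deriv i f (P z x)) has_field_derivative
          coord_deriv j (coord_deriv i f) (P z w)) (at w)"
        by (simp add: P_def)
      then have "((\<lambda>w. coord_deriv i f (P z w) - w * A) has_field_derivative
          coord_deriv j (coord_deriv i f) (P z w) - A) (at w)"
        by (auto intro!: derivative_eq_intros)
      then show "((\<lambda>w. coord_deriv i f (P z w) - w * A) has_field_derivative
          coord_deriv j (coord_deriv i f) (P z w) - A) (at w within ?W)"
        by (rule has_field_derivative_at_within)
    qed (use ZW z b in auto)
    \<comment> \<open>Second direction: the derivative in \<open>z\<close> is the difference
      estimated by \<open>inner\<close>, so it is at most \<open>\<epsilon> * r\<close>.\<close>
    have "norm ((f (P (t $ i + of_real r) b) - f (P (t $ i + of_real r) (t $ j)) - (t $ i + of_real r) * (of_real r * A))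
        - (f (P (t $ i) b) - f (P (t $ i) (t $ j)) - t $ i * (of_real r * A)))
        \<le> (\<epsilon> * r) * norm (t $ i + of_real r - t $ i)"
    proof (rule field_differentiable_bound[of ?Z "\<lambda>z. f (P z b) - f (P z (t $ j)) - z * (of_real r * A)"
          "\<lambda>z. coord_deriv i f (P z b) - coord_deriv i f (P z (t $ j)) - of_real r * A"])
      fix z assume z: "z \<in> ?Z"
      have *: "((\<lambda>x. f (P x w)) has_field_derivative coord_deriv i f (P z w)) (at z)"
        if "w \<in> ?W" for w
      proof -
        have "((\<lambda>x. f (upd i (P z w) x)) has_field_derivative
            coord_deriv i f (P z w)) (at (P z w $ i))"
          using ZW[OF z that] f by (intro partial_diffD smooth_on_partial_diff)
        moreover have "upd i (P z w) x = P x w" "P z w $ i = z" for x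
          using \<open>i \<noteq> j\<close> by (auto simp: P_def upd_def vec_eq_iff)
        ultimately show ?thesis by simp
      qed
      have "((\<lambda>z. f (P z b) - f (P z (t $ j)) - z * (of_real r * A)) has_field_derivative
          coord_deriv i f (P z b) - coord_deriv i f (P z (t $ j)) - of_real r * A) (at z)"
        using *[OF b(1)] *[OF b(2)] by (auto intro!: derivative_eq_intros)
      then show "((\<lambda>z. f (P z b) - f (P z (t $ j)) - z * (of_real r * A)) has_field_derivative
          coord_deriv i f (P z b) - coord_deriv i f (P z (t $ j)) - of_real r * A) (at z within ?Z)"
        by (rule has_field_derivative_at_within)
      have eq: "coord_deriv i f (P z b) - coord_deriv i f (P z (t $ j)) - of_real r * A
          = (coord_deriv i f (P z b) - b * A) - (coord_deriv i f (P z (t $ j)) - t $ j * A)"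
        by (simp add: b_def algebra_simps)
      show "norm (coord_deriv i f (P z b) - coord_deriv i f (P z (t $ j)) - of_real r * A) \<le> \<epsilon> * r"
        using inner[OF z] r unfolding eq by (simp add: b_def)
    qed (use a in auto)
    moreover have "P z (t $ j) = upd i t z" "P (t $ i) w = upd j t w" for z w
      using \<open>i \<noteq> j\<close> by (auto simp: P_def upd_def vec_eq_iff)
    ultimately have "norm ((f (P (t $ i + of_real r) b) - f (upd i t (t $ i + of_real r))
          - (t $ i + of_real r) * (of_real r * A)) - (f (upd j t b) - f t - t $ i * (of_real r * A)))
        \<le> \<epsilon> * r\<^sup>2"
      using r by (simp add: power2_eq_square)
    moreover have "(x1 - x2 - (a + \<rho>) * (\<rho> * A)) - (x3 - x4 - a * (\<rho> * A))
        = x1 - x2 - x3 + x4 - \<rho>\<^sup>2 * A" for x1 x2 x3 x4 a \<rho> :: 'k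
      by (simp add: power2_eq_square algebra_simps)
    ultimately show ?thesis by (simp only: P_def b_def)
  qed
  then show ?thesis
    unfolding A_def eventually_at_right_field using d1(1) d2(1)
    by (intro exI[of _ "min d1 d2"]) auto
qed

text \<open>The second difference is symmetric in \<open>i\<close> and \<open>j\<close>, so both
  mixed derivatives approximate the same number. The two bounds are compared at one small
  \<open>r\<close> and divided by its square.\<close>

lemma coord_deriv_commute:
  fixes f :: "'k::real_normed_field ^ 'n::finite \<Rightarrow> 'k"
  assumes S: "open S" "t \<in> S" and f: "smooth_on S f"
  shows "coord_deriv i (coord_deriv j f) t = coord_deriv j (coord_deriv i f) t"
proof (cases "i = j")
  case False
  define A where "A = coord_deriv j (coord_deriv i f) t"
  define B where "B = coord_deriv i (coord_deriv j f) t"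
  have "norm (B - A) \<le> 2 * \<epsilon>" if "\<epsilon> > 0" for \<epsilon>
  proof -
    have "\<forall>\<^sub>F r in at_right (0::real). norm (B - A) \<le> 2 * \<epsilon>"
      using mixed_difference_bound[OF S f False that]
        mixed_difference_bound[OF S f False[symmetric] that] eventually_at_right_less[of 0]
    proof eventually_elim
      case (elim r)
      define X a b where "X = f (upd j (upd i t (t $ i + of_real r)) (t $ j + of_real r))"
        and "a = f (upd i t (t $ i + of_real r))" and "b = f (upd j t (t $ j + of_real r))"
      have "norm (X - a - b + f t - (of_real r)\<^sup>2 * A) \<le> \<epsilon> * r\<^sup>2"
        using elim(1) unfolding X_def a_def b_def A_def .
      moreover have "norm (X - b - a + f t - (of_real r)\<^sup>2 * B) \<le> \<epsilon> * r\<^sup>2"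
        using elim(2) unfolding upd_commute[OF False] X_def a_def b_def B_def .
      moreover have "(X - a - b + f t - (of_real r)\<^sup>2 * A) - (X - b - a + f t - (of_real r)\<^sup>2 * B)
          = (of_real r)\<^sup>2 * (B - A)"
        by (simp add: algebra_simps)
      ultimately have "norm ((of_real r)\<^sup>2 * (B - A)) \<le> \<epsilon> * r\<^sup>2 + \<epsilon> * r\<^sup>2"
        by (metis norm_triangle_le_diff add_mono)
      then have "r\<^sup>2 * norm (B - A) \<le> r\<^sup>2 * (2 * \<epsilon>)"
        by (simp add: norm_mult norm_power mult_ac)
      moreover have "r\<^sup>2 > 0" using elim(3) by simp
      ultimately show ?case by (rule mult_le_cancel_left_pos[THEN iffD1, rotated])
    qed
    then show ?thesis by simp
  qed
  from this[of "\<epsilon> / 2" for \<epsilon>] have "norm (B - A) \<le> 0 + \<epsilon>" if "\<epsilon> > 0" for \<epsilon>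
    using that by simp
  then have "norm (B - A) \<le> 0" by (rule field_le_epsilon)
  then show ?thesis by (simp add: A_def B_def)
qed simp

section \<open>Ordinary differential operators in x built from the stationary recursion\<close>

lemma has_coord_deriv:
  "smooth_on S f \<Longrightarrow> t \<in> S \<Longrightarrow>
    ((\<lambda>z. f (upd j t z)) has_field_derivative coord_deriv j f t) (at (t $ j))"
  by (rule partial_diffD[OF smooth_on_partial_diff])

text \<open>Commutation with \<open>L\<close> and the formula for the square involve derivatives in
  \<open>x\<close> only, so they are separated from the flows. Here \<open>q\<close> stands for
  \<open>u 1\<close>, \<open>v i\<close> for the coefficients of \<open>2 - \<uu>\<close>, and
  \<open>recursion\<close> is the stationary equation at degree \<open>i\<close>.\<close>

locale stationary_recursion =
  fixes S :: "('k::real_normed_field ^ 'n::finite) set" and x :: 'n and g :: nat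
    and q :: "'k ^ 'n \<Rightarrow> 'k" and v :: "nat \<Rightarrow> 'k ^ 'n \<Rightarrow> 'k"
  assumes S: "open S" and smooth_q: "smooth_on S q" and smooth_v: "\<And>i. smooth_on S (v i)"
    and v_0: "v 0 = (\<lambda>_. 2)" and v_top: "v (Suc g) = (\<lambda>_. 0)"
    and recursion: "\<And>i t. i \<le> g \<Longrightarrow> t \<in> S \<Longrightarrow>
      4 * coord_deriv x (v (Suc i)) t = (coord_deriv x ^^ 3) (v i) t
        - 2 * coord_deriv x q t * v i t - 4 * q t * coord_deriv x (v i) t"
begin

abbreviation "D \<equiv> coord_deriv x"

definition L :: "('k, 'n) oper" where "L f = (\<lambda>t. D (D f) t - q t * f t)"

definition A :: "nat \<Rightarrow> ('k, 'n) oper" where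
  "A i f = (\<lambda>t. 1/2 * (v i t * D f t) - 1/4 * (D (v i) t * f t))"

definition W :: "('k, 'n) oper" where "W f = (\<lambda>t. \<Sum>i\<le>g. A i ((L ^^ (g - i)) f) t)"

lemma smooth_L: "smooth_on S f \<Longrightarrow> smooth_on S (L f)"
  unfolding L_def by (intro smooth_on_intros S smooth_q)

lemma smooth_L_pow: "smooth_on S f \<Longrightarrow> smooth_on S ((L ^^ n) f)"
  by (induction n) (auto intro: smooth_L)

lemma smooth_A: "smooth_on S f \<Longrightarrow> smooth_on S (A i f)"
  unfolding A_def by (intro smooth_on_intros S smooth_v)

lemma smooth_W: "smooth_on S f \<Longrightarrow> smooth_on S (W f)"
  unfolding W_def by (intro smooth_on_intros S smooth_A smooth_L_pow)

text \<open>Operator identities are available only on \<open>S\<close> and for smooth arguments, so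
  rewriting under an operator goes through congruences of this kind.\<close>

lemma L_cong: "(\<And>s. s \<in> S \<Longrightarrow> f s = h s) \<Longrightarrow> t \<in> S \<Longrightarrow> L f t = L h t"
  unfolding L_def by (auto intro!: coord_deriv_cong[OF S] arg_cong2[where f = minus])

lemma A_cong: "(\<And>s. s \<in> S \<Longrightarrow> f s = h s) \<Longrightarrow> t \<in> S \<Longrightarrow> A i f t = A i h t"
  unfolding A_def by (auto simp: coord_deriv_cong[OF S, of t f h])

lemma L_pow_cong:
  assumes "\<And>s. s \<in> S \<Longrightarrow> f s = h s" "t \<in> S"
  shows "(L ^^ n) f t = (L ^^ n) h t"
  using assms(2)
proof (induction n arbitrary: t)
  case (Suc n)
  then show ?case using L_cong[of "(L ^^ n) f" "(L ^^ n) h" t] by auto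
qed (use assms in simp)

lemma W_cong: "(\<And>s. s \<in> S \<Longrightarrow> f s = h s) \<Longrightarrow> t \<in> S \<Longrightarrow> W f t = W h t"
  unfolding W_def by (intro sum.cong refl A_cong L_pow_cong)

lemma D_sum:
  "(\<And>i. i \<in> I \<Longrightarrow> smooth_on S (F i)) \<Longrightarrow> t \<in> S \<Longrightarrow> D (\<lambda>s. \<Sum>i\<in>I. F i s) t = (\<Sum>i\<in>I. D (F i) t)"
  by (intro coord_derivI DERIV_sum has_coord_deriv)

lemma L_sum:
  assumes F: "\<And>i. i \<in> I \<Longrightarrow> smooth_on S (F i)" and t: "t \<in> S"
  shows "L (\<lambda>s. \<Sum>i\<in>I. F i s) t = (\<Sum>i\<in>I. L (F i) t)"
proof -
  have "D (D (\<lambda>s. \<Sum>i\<in>I. F i s)) t = D (\<lambda>s. \<Sum>i\<in>I. D (F i) s) t"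
    by (intro coord_deriv_cong[OF S t] D_sum F)
  also have "\<dots> = (\<Sum>i\<in>I. D (D (F i)) t)"
    by (intro D_sum smooth_on_intros F t)
  finally show ?thesis by (simp add: L_def sum_subtractf sum_distrib_left)
qed

lemma A_sum:
  assumes F: "\<And>i. i \<in> I \<Longrightarrow> smooth_on S (F i)" and t: "t \<in> S"
  shows "A k (\<lambda>s. \<Sum>i\<in>I. F i s) t = (\<Sum>i\<in>I. A k (F i) t)"
proof -
  have "D (\<lambda>s. \<Sum>i\<in>I. F i s) t = (\<Sum>i\<in>I. D (F i) t)"
    using F t by (rule D_sum)
  then show ?thesis by (simp only: A_def sum_subtractf sum_distrib_left)
qed

lemma D_A:
  assumes f: "smooth_on S f" and t: "t \<in> S"
  shows "D (A i f) t = 1/2 * (D (v i) t * D f t + v i t * D (D f) t)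
    - 1/4 * (D (D (v i)) t * f t + D (v i) t * D f t)"
  unfolding A_def
  by (rule coord_derivI)
    (auto intro!: derivative_eq_intros has_coord_deriv smooth_on_coord_deriv f smooth_v t
      simp: field_simps)

text \<open>The weights 1/2 and 1/4 in \<open>A\<close> make the terms in \<open>D f\<close> cancel
  in the commutator, leaving \<open>D (v i)\<close> times the second derivative and a multiple of
  \<open>f\<close>. Once the second derivative is written as \<open>L f\<close> plus
  \<open>q\<close> times \<open>f\<close>, the recursion identifies that multiple as
  \<open>- D (v (Suc i))\<close>.\<close>

lemma L_A:
  assumes f: "smooth_on S f" and t: "t \<in> S" and i: "i \<le> g"
  shows "L (A i f) t = A i (L f) t + D (v i) t * L f t - D (v (Suc i)) t * f t"
proof -
  have "D (D (A i f)) t = D (\<lambda>t. 1/2 * (D (v i) t * D f t + v i t * D (D f) t)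
    - 1/4 * (D (D (v i)) t * f t + D (v i) t * D f t)) t"
    by (intro coord_deriv_cong[OF S t] D_A f)
  also have "\<dots> = 1/2 * (D (D (v i)) t * D f t + 2 * D (v i) t * D (D f) t + v i t * D (D (D f)) t)
    - 1/4 * (D (D (D (v i))) t * f t + 2 * D (D (v i)) t * D f t + D (v i) t * D (D f) t)"
    by (rule coord_derivI)
      (auto intro!: derivative_eq_intros has_coord_deriv smooth_on_coord_deriv f smooth_v t
        simp: field_simps)
  finally have DDA: "D (D (A i f)) t = \<dots>" .
  have DL: "D (L f) t = D (D (D f)) t - (D q t * f t + q t * D f t)"
    unfolding L_def by (rule coord_derivI)
      (auto intro!: derivative_eq_intros has_coord_deriv smooth_on_coord_deriv f smooth_q t)
  have rec: "D (v (Suc i)) t = 1/4 * D (D (D (v i))) t - 1/2 * D q t * v i t - q t * D (v i) t"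
    using recursion[OF i t] by (simp add: field_simps numeral_3_eq_3)
  show ?thesis
    unfolding L_def[of "A i f"] DDA rec A_def[of i "L f"] DL
    by (simp add: A_def L_def field_simps)
qed

lemma L_W:
  assumes f: "smooth_on S f" and t: "t \<in> S"
  shows "L (W f) t = W (L f) t"
proof -
  define F where "F n = (L ^^ n) f" for n
  have F: "smooth_on S (F n)" for n unfolding F_def by (rule smooth_L_pow[OF f])
  have LF: "L (F (g - i)) = F (Suc g - i)" if "i \<le> g" for i
    using that by (simp add: F_def Suc_diff_le)
  have "L (W f) t = (\<Sum>i\<le>g. L (A i (F (g - i))) t)"
    unfolding W_def F_def[symmetric] by (intro L_sum smooth_A F t)
  \<comment> \<open>With \<open>g - i\<close> written as \<open>Suc g - Suc i\<close>, the
    correction is a difference of consecutive values of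
    \<open>D (v i) t * F (Suc g - i) t\<close>.\<close>
  also have "\<dots> = (\<Sum>i\<le>g. A i (F (Suc g - i)) t +
      (D (v i) t * F (Suc g - i) t - D (v (Suc i)) t * F (Suc g - Suc i) t))"
    by (intro sum.cong refl) (simp add: L_A[OF F t] LF)
  also have "\<dots> = (\<Sum>i\<le>g. A i (F (Suc g - i)) t)
      + (D (v 0) t * F (Suc g) t - D (v (Suc g)) t * F 0 t)"
    unfolding sum.distrib by (subst sum_telescope) simp
  \<comment> \<open>Both ends of the telescoping sum vanish because \<open>v 0\<close> and
    \<open>v (Suc g)\<close> are constant.\<close>
  also have "D (v 0) t = 0"
    unfolding v_0 by (auto intro!: coord_derivI)
  also have "D (v (Suc g)) t = 0"
    unfolding v_top by (auto intro!: coord_derivI)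
  also have "(\<Sum>i\<le>g. A i (F (Suc g - i)) t) = W (L f) t"
    unfolding W_def F_def by (intro sum.cong refl) (simp add: Suc_diff_le funpow_swap1)
  finally show ?thesis by simp
qed

lemma L_pow_W:
  assumes f: "smooth_on S f" and t: "t \<in> S"
  shows "(L ^^ n) (W f) t = W ((L ^^ n) f) t"
  using t
proof (induction n arbitrary: t)
  case (Suc n)
  have "(L ^^ Suc n) (W f) t = L (W ((L ^^ n) f)) t"
    using L_cong[of "(L ^^ n) (W f)" "W ((L ^^ n) f)" t] Suc by simp
  then show ?case using L_W[OF smooth_L_pow[OF f] Suc.prems] by simp
qed simp

text \<open>The second derivative of \<open>f\<close> is absorbed into \<open>L f\<close>. The
  coefficient of \<open>D f\<close> that remains is antisymmetric in \<open>i\<close> and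
  \<open>k\<close>, so it will cancel in a double sum.\<close>

lemma A_A:
  assumes f: "smooth_on S f" and t: "t \<in> S"
  shows "4 * A i (A k f) t = v i t * v k t * L f t
    + (q t * v i t * v k t - 1/2 * (v i t * D (D (v k)) t) + 1/4 * (D (v i) t * D (v k) t)) * f t
    + 1/2 * (v i t * D (v k) t - D (v i) t * v k t) * D f t"
  unfolding A_def[of i "A k f"] D_A[OF f t] by (simp add: A_def L_def field_simps)

lemma W_W:
  assumes f: "smooth_on S f" and t: "t \<in> S"
  shows "W (W f) t = (\<Sum>i\<le>g. \<Sum>k\<le>g. A i (A k ((L ^^ (2 * g - (i + k))) f)) t)"
proof -
  have "W (W f) t = (\<Sum>i\<le>g. A i (W ((L ^^ (g - i)) f)) t)"
    \<comment> \<open>\<open>L_pow_W\<close> moves each outer power of \<open>L\<close> to the right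
      of the inner \<open>W\<close>, where it merges with the inner power.\<close>
    unfolding W_def[of "W f"] by (intro sum.cong refl A_cong[OF _ t] L_pow_W f)
  also have "\<dots> = (\<Sum>i\<le>g. \<Sum>k\<le>g. A i (A k ((L ^^ (g - k)) ((L ^^ (g - i)) f))) t)"
    unfolding W_def by (intro sum.cong refl A_sum smooth_A smooth_L_pow f t)
  also have "\<dots> = (\<Sum>i\<le>g. \<Sum>k\<le>g. A i (A k ((L ^^ (2 * g - (i + k))) f)) t)"
  proof (intro sum.cong refl)
    fix i k assume "i \<in> {..g}" "k \<in> {..g}"
    \<comment> \<open>The truncated subtraction splits exactly because \<open>i\<close> and
      \<open>k\<close> are at most \<open>g\<close>.\<close>
    then have "2 * g - (i + k) = (g - k) + (g - i)" by simp
    then show "A i (A k ((L ^^ (g - k)) ((L ^^ (g - i)) f))) t = A i (A k ((L ^^ (2 * g - (i + k))) f)) t"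
      by (simp add: funpow_add)
  qed
  finally show ?thesis .
qed

lemma W_W_expand:
  assumes f: "smooth_on S f" and t: "t \<in> S"
  shows "16 * W (W f) t = (\<Sum>i\<le>g. \<Sum>k\<le>g. 4 * (v i t * v k t * (L ^^ (2 * g + 1 - (i + k))) f t)
    + (4 * q t * v i t * v k t - 2 * (D (D (v i)) t * v k t) + D (v i) t * D (v k) t)
      * (L ^^ (2 * g - (i + k))) f t)"
proof -
  define F where "F n = (L ^^ n) f" for n
  \<comment> \<open>\<open>a\<close> collects the terms symmetric in the indices, \<open>b\<close>
    those with a second derivative of a coefficient, and \<open>c\<close> the first-order part,
    entering as \<open>c i k - c k i\<close>.\<close>
  define a where "a i k = 4 * (v i t * v k t * F (2 * g + 1 - (i + k)) t)
    + (4 * q t * v i t * v k t + D (v i) t * D (v k) t) * F (2 * g - (i + k)) t" for i k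
  define b where "b i k = 2 * (v i t * D (D (v k)) t * F (2 * g - (i + k)) t)" for i k
  define c where "c i k = 2 * (v i t * D (v k) t * D (F (2 * g - (i + k))) t)" for i k
  have swap: "(\<Sum>i\<le>g. \<Sum>k\<le>g. z i k) = (\<Sum>i\<le>g. \<Sum>k\<le>g. z k i)" for z :: "nat \<Rightarrow> nat \<Rightarrow> 'k"
    by (rule sum.swap)
  have "16 * A i (A k (F (2 * g - (i + k)))) t = a i k - b i k + (c i k - c k i)"
    if "i \<le> g" "k \<le> g" for i k
  proof -
    have "L (F (2 * g - (i + k))) = F (2 * g + 1 - (i + k))"
      using that by (simp add: F_def Suc_diff_le)
    moreover have "smooth_on S (F n)" for n
      unfolding F_def by (rule smooth_L_pow[OF f])
    ultimately have "4 * (4 * A i (A k (F (2 * g - (i + k)))) t) = a i k - b i k + (c i k - c k i)"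
      using t by (subst A_A) (simp_all add: a_def b_def c_def algebra_simps add.commute[of k i])
    then show ?thesis by simp
  qed
  then have "16 * W (W f) t = (\<Sum>i\<le>g. \<Sum>k\<le>g. a i k - b i k + (c i k - c k i))"
    unfolding W_W[OF f t] F_def[symmetric] sum_distrib_left by (intro sum.cong refl) auto
  \<comment> \<open>Exchanging the indices cancels \<open>c\<close> and moves the second derivative
    in \<open>b\<close> onto \<open>v i\<close>, the order of factors in the equation for
    \<open>\<mu>\<close>.\<close>
  also have "\<dots> = (\<Sum>i\<le>g. \<Sum>k\<le>g. a i k) - (\<Sum>i\<le>g. \<Sum>k\<le>g. b k i)"
    unfolding sum.distrib sum_subtractf swap[of c] swap[of b] by simp
  finally show ?thesis
    unfolding sum_subtractf[symmetric] F_def[symmetric]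
    by (simp add: a_def b_def algebra_simps add.commute)
qed

end

section \<open>Coefficients of Laurent series and their evaluation at powers of L\<close>

lemma fls_nth_const_X_power: "fls_nth (fls_const c * fls_X ^ i) n = (if n = int i then c else 0)"
  by simp

lemma fls_nth_polynomial:
  assumes "finite I"
  shows "fls_nth (\<Sum>i\<in>I. fls_const (c i) * fls_X ^ i) n = (if 0 \<le> n \<and> nat n \<in> I then c (nat n) else 0)"
proof -
  have "fls_nth (\<Sum>i\<in>I. fls_const (c i) * fls_X ^ i) n
      = (\<Sum>i\<in>I. if i = nat n then (if 0 \<le> n then c (nat n) else 0) else 0)"
    unfolding fls_nth_sum by (intro sum.cong refl) (auto simp: fls_nth_const_X_power)
  then show ?thesis using assms by simp
qed

lemma gen_nth: "fls_nth (gen g w t) n = (if 1 \<le> n \<and> n \<le> int g then w (nat n) t else 0)"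
  unfolding gen_def by (subst fls_nth_polynomial) auto

text \<open>Degree 1 of the flow equation is what governs the derivatives of \<open>u 1\<close>. The
  factor \<open>fls_X_intpow (int j - int k + 1)\<close> shifts index 1 to
  \<open>k - j\<close>.\<close>

lemma D_trunc_times_nth_1:
  "fls_nth (D_trunc k f * h) 1 = 1/2 * (\<Sum>j<k. fls_nth f (int j) * fls_nth h (int (k - j)))"
proof -
  have "D_trunc k f * h = fls_const (1/2) * (\<Sum>j<k. fls_const (fls_nth f (int j)) *
      (fls_X_intpow (int j - int k + 1) * h))"
    by (simp only: D_trunc_def mult.assoc sum_distrib_right)
  then have "fls_nth (D_trunc k f * h) 1 = 1/2 * fls_nth (\<Sum>j<k. fls_const (fls_nth f (int j)) *
      (fls_X_intpow (int j - int k + 1) * h)) 1"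
    by (simp only: fls_mult_const_nth)
  then show ?thesis
    unfolding fls_nth_sum fls_X_intpow_times_conv_shift by (simp add: of_nat_diff)
qed

text \<open>The full convolutions, including \<open>j = k\<close>, agree by symmetry, so the
  truncated ones differ only by the omitted end terms.\<close>

lemma sum_convolution_commute_diff:
  fixes a b :: "nat \<Rightarrow> 'a::comm_ring"
  shows "(\<Sum>j<k. a j * b (k - j)) - (\<Sum>j<k. b j * a (k - j)) = a 0 * b k - b 0 * a k"
proof -
  have "(\<Sum>j\<le>k. a j * b (k - j)) = (\<Sum>j\<le>k. b j * a (k - j))"
    by (rule sum.reindex_bij_witness[of _ "\<lambda>j. k - j" "\<lambda>j. k - j"]) (auto simp: mult.commute)
  then show ?thesis
    by (simp add: lessThan_Suc_atMost[symmetric] algebra_simps)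
qed

text \<open>
  With \<open>G n\<close> the value of \<open>L\<^sup>n f\<close> at a point, this turns an identity in \<open>\<xi>\<close> into one between
  operators in \<open>L\<close>, through \<open>\<xi>\<^sup>n \<mapsto> L\<^sup>N\<^sup>-\<^sup>n\<close>. The lowest degree is \<open>-1\<close>.
\<close>

definition fls_eval :: "(nat \<Rightarrow> 'k::field) \<Rightarrow> nat \<Rightarrow> 'k fls \<Rightarrow> 'k" where
  "fls_eval G N P = (\<Sum>k=-1..int N. fls_nth P k * G (nat (int N - k)))"

lemma fls_eval_add: "fls_eval G N (P + Q) = fls_eval G N P + fls_eval G N Q"
  and fls_eval_diff: "fls_eval G N (P - Q) = fls_eval G N P - fls_eval G N Q"
  and fls_eval_const_mult: "fls_eval G N (fls_const c * P) = c * fls_eval G N P"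
  and fls_eval_numeral_mult: "fls_eval G N (numeral m * P) = numeral m * fls_eval G N P"
  by (simp_all add: fls_eval_def sum.distrib sum_subtractf sum_distrib_left algebra_simps)

lemma fls_eval_sum: "fls_eval G N (\<Sum>i\<in>I. P i) = (\<Sum>i\<in>I. fls_eval G N (P i))"
  unfolding fls_eval_def fls_nth_sum sum_distrib_right by (rule sum.swap)

lemma fls_eval_monomial:
  assumes "n \<le> N"
  shows "fls_eval G N (fls_const c * fls_X ^ n) = c * G (N - n)"
proof -
  have "fls_eval G N (fls_const c * fls_X ^ n) = (\<Sum>k=-1..int N. if k = int n then c * G (N - n) else 0)"
    unfolding fls_eval_def by (intro sum.cong refl) (auto simp: nat_diff_distrib)
  then show ?thesis using assms by simp
qed

lemma fls_eval_X_inv_monomial: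
  assumes "n \<le> N"
  shows "fls_eval G N (fls_X_inv * (fls_const c * fls_X ^ n)) = c * G (N + 1 - n)"
proof -
  have "fls_eval G N (fls_X_inv * (fls_const c * fls_X ^ n))
      = (\<Sum>k=-1..int N. if k = int n - 1 then c * G (N + 1 - n) else 0)"
    unfolding fls_eval_def
  proof (intro sum.cong refl)
    fix k
    have "nat (int N - (int n - 1)) = N + 1 - n" by simp
    then show "fls_nth (fls_X_inv * (fls_const c * fls_X ^ n)) k * G (nat (int N - k))
        = (if k = int n - 1 then c * G (N + 1 - n) else 0)"
      by (auto simp: fls_X_inv_times_conv_shift)
  qed
  then show ?thesis using assms by simp
qed

section \<open>The square of W as a polynomial in L\<close>

context stationary_recursion
begin

text \<open>In \<open>W_W_expand\<close> every coefficient stands to the left of a power of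
  \<open>L\<close>, so at a fixed \<open>t\<close> it is a scalar factor of some \<open>G n\<close>.
  This is why a scalar identity in \<xi> can be evaluated term by term without regard to operator
  ordering.\<close>

lemma W_W_eq:
  fixes \<mu> :: "nat \<Rightarrow> 'k"
  defines "pol \<equiv> \<lambda>a. \<Sum>i\<le>g. fls_const (a i) * fls_X ^ i"
  assumes f: "smooth_on S f" and t: "t \<in> S"
    and mu: "4 * (4 * fls_X_inv + (\<Sum>i=1..2*g. fls_const (\<mu> i) * fls_X ^ i))
      = (pol (\<lambda>i. D (v i) t))\<^sup>2 - 2 * pol (\<lambda>i. D (D (v i)) t) * pol (\<lambda>i. v i t)
        + 4 * (fls_X_inv + fls_const (q t)) * (pol (\<lambda>i. v i t))\<^sup>2"
  shows "4 * W (W f) t = 4 * (L ^^ (2 * g + 1)) f t + (\<Sum>i=1..2*g. \<mu> i * (L ^^ (2 * g - i)) f t)"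
proof -
  define G where "G n = (L ^^ n) f t" for n
  let ?E = "fls_eval G (2 * g)"
  have pol_mult: "pol a * pol b = (\<Sum>i\<le>g. \<Sum>k\<le>g. fls_const (a i * b k) * fls_X ^ (i + k))" for a b
    unfolding pol_def sum_product
    by (simp add: power_add mult_ac flip: fls_const_mult_const)
  have E: "?E (pol a * pol b) = (\<Sum>i\<le>g. \<Sum>k\<le>g. a i * b k * G (2 * g - (i + k)))" for a b
    unfolding pol_mult fls_eval_sum by (intro sum.cong refl fls_eval_monomial) auto
  have E_inv: "?E (fls_X_inv * (pol a * pol b))
      = (\<Sum>i\<le>g. \<Sum>k\<le>g. a i * b k * G (2 * g + 1 - (i + k)))" for a b
    unfolding pol_mult fls_eval_sum sum_distrib_left
    by (intro sum.cong refl fls_eval_X_inv_monomial) auto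
  \<comment> \<open>This evaluation produces the leading power of \<open>L\<close>.\<close>
  have E_X_inv: "?E fls_X_inv = G (2 * g + 1)"
    using fls_eval_X_inv_monomial[of 0 "2 * g" G 1] by simp
  have E_mu: "?E (\<Sum>i=1..2*g. fls_const (\<mu> i) * fls_X ^ i) = (\<Sum>i=1..2*g. \<mu> i * G (2 * g - i))"
    unfolding fls_eval_sum by (intro sum.cong refl fls_eval_monomial) auto
  define V V1 V2 where "V = pol (\<lambda>i. v i t)" and "V1 = pol (\<lambda>i. D (v i) t)"
    and "V2 = pol (\<lambda>i. D (D (v i)) t)"
  have "4 * (4 * fls_X_inv + (\<Sum>i=1..2*g. fls_const (\<mu> i) * fls_X ^ i))
      = V1 * V1 - 2 * (V2 * V) + 4 * (fls_X_inv * (V * V)) + 4 * (fls_const (q t) * (V * V))"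
    unfolding mu V_def[symmetric] V1_def[symmetric] V2_def[symmetric]
    by (simp add: power2_eq_square algebra_simps)
  then have "?E (4 * (4 * fls_X_inv + (\<Sum>i=1..2*g. fls_const (\<mu> i) * fls_X ^ i)))
      = ?E (V1 * V1 - 2 * (V2 * V) + 4 * (fls_X_inv * (V * V)) + 4 * (fls_const (q t) * (V * V)))"
    by (rule arg_cong)
  then have "4 * (4 * G (2 * g + 1) + (\<Sum>i=1..2*g. \<mu> i * G (2 * g - i))) = 16 * W (W f) t"
    unfolding fls_eval_add fls_eval_diff fls_eval_const_mult fls_eval_numeral_mult
      V_def V1_def V2_def E E_inv E_X_inv E_mu W_W_expand[OF f t] G_def[symmetric]
    by (simp add: sum_distrib_left sum.distrib[symmetric] sum_subtractf[symmetric] algebra_simps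
        del: sum.distrib sum_subtractf)
  then have "4 * (4 * W (W f) t) = 4 * (4 * G (2 * g + 1) + (\<Sum>i=1..2*g. \<mu> i * G (2 * g - i)))"
    by simp
  then show ?thesis unfolding mult_cancel_left G_def by simp
qed

end

section \<open>From the operators U_i to W, and the relation itself\<close>

lemma coord_deriv_pow_uminus:
  fixes f :: "'k::real_normed_field ^ 'n::finite \<Rightarrow> 'k"
  assumes S: "open S" "t \<in> S" and f: "smooth_on S f"
  shows "(coord_deriv j ^^ m) (\<lambda>s. - f s) t = - (coord_deriv j ^^ m) f t"
  using S(2)
proof (induction m arbitrary: t)
  case (Suc m)
  have "smooth_on S ((coord_deriv j ^^ m) f)"
    by (induction m) (auto intro: smooth_on_coord_deriv f)
  then have "coord_deriv j (\<lambda>s. - (coord_deriv j ^^ m) f s) t = - coord_deriv j ((coord_deriv j ^^ m) f) t"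
    by (intro coord_derivI) (auto intro!: derivative_eq_intros has_coord_deriv Suc.prems)
  moreover have "coord_deriv j ((coord_deriv j ^^ m) (\<lambda>s. - f s)) t
      = coord_deriv j (\<lambda>s. - (coord_deriv j ^^ m) f s) t"
    by (intro coord_deriv_cong[OF S(1) Suc.prems] Suc.IH)
  ultimately show ?case by simp
qed simp

lemma sum_oper_apply: "(\<Sum>i\<in>I. F i) f t = (\<Sum>i\<in>I. F i f t)"
  for F :: "'i \<Rightarrow> ('k::real_normed_field, 'n::finite) oper"
  by (induction I rule: infinite_finite_induct) auto

theorem lemma6p1:
  fixes \<Omega> :: "('k::real_normed_field ^ 'n::finite) set"
    and g :: nat
    and e :: "nat \<Rightarrow> 'n"
    and u :: "nat \<Rightarrow> 'k ^ 'n \<Rightarrow> 'k"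
    and \<mu> :: "nat \<Rightarrow> 'k"
  defines "\<uu> \<equiv> gen g u"
    and "\<uu>1 \<equiv> gen g (\<lambda>i. pd g e 1 (u i))"
    and "\<uu>2 \<equiv> gen g (\<lambda>i. (pd g e 1 ^^ 2) (u i))"
    and "\<uu>3 \<equiv> gen g (\<lambda>i. (pd g e 1 ^^ 3) (u i))"
    and "L \<equiv> L_op g e u"
    and "U \<equiv> U_op g e u"
  assumes coords: "bij_betw e {1..g} (UNIV :: 'n set)"
    and dom: "open \<Omega>"
    and smooth: "\<And>i. i \<in> {1..g} \<Longrightarrow> smooth_on \<Omega> (u i)"
    and stationary: "\<And>t. t \<in> \<Omega> \<Longrightarrow>
          \<uu>3 t + 2 * fls_const (pd g e 1 (u 1) t) * (2 - \<uu> t)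
            - 4 * (fls_X_inv + fls_const (u 1 t)) * \<uu>1 t = 0"
    and flows: "\<And>k t. k \<in> {1..g} \<Longrightarrow> t \<in> \<Omega> \<Longrightarrow>
          gen g (\<lambda>i. pd g e k (u i)) t
            = D_trunc k (2 - \<uu> t) * \<uu>1 t - D_trunc k (\<uu>1 t) * (2 - \<uu> t)"
    and mu: "\<And>t. t \<in> \<Omega> \<Longrightarrow>
          4 * (4 * fls_X_inv + (\<Sum>i=1..2*g. fls_const (\<mu> i) * fls_X ^ i))
            = (\<uu>1 t)\<^sup>2 + 2 * \<uu>2 t * (2 - \<uu> t)
              + 4 * (fls_X_inv + fls_const (u 1 t)) * (2 - \<uu> t)\<^sup>2"
  shows "\<forall>f. smooth_on \<Omega> f \<longrightarrow> (\<forall>t\<in>\<Omega>.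
          (const_op 4 \<circ> (\<Sum>i=1..g. U i \<circ> L ^^ (g - i)) ^^ 2) f t
            = ((const_op 4 \<circ> L ^^ (2*g + 1)) + (\<Sum>i=1..2*g. const_op (\<mu> i) \<circ> L ^^ (2*g - i))) f t)"
proof (intro allI impI ballI)
  fix f t assume f: "smooth_on \<Omega> f" and t: "t \<in> \<Omega>"
  \<comment> \<open>The coordinate type is nonempty, so the coordinate \<open>e 1\<close>
    exists.\<close>
  have "g \<noteq> 0"
    using coords by (auto simp: bij_betw_def)
  define x where "x = e 1"
  let ?D = "coord_deriv x"
  have pd_1: "pd g e 1 = ?D" "pd g e (Suc 0) = ?D"
    using \<open>g \<noteq> 0\<close> by (simp_all add: pd_def x_def)
  \<comment> \<open>These are the coefficients of \<open>2 - \<uu>\<close>, continued by 0 past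
    degree \<open>g\<close> to supply the upper boundary value required by the locale.\<close>
  define v where "v i = (if i = 0 then (\<lambda>_. 2) else if i \<le> g then (\<lambda>t. - u i t) else (\<lambda>_. 0))" for i
  have v_smooth: "smooth_on \<Omega> (v i)" for i
    using smooth_on_uminus[OF dom smooth, of i] by (auto simp: v_def intro: smooth_on_const)
  have D_pow_const: "(?D ^^ m) (\<lambda>_. c) s = (if m = 0 then c else 0)" for m c s
    by (induction m arbitrary: s) (auto intro!: coord_derivI simp: fun_eq_iff)
  have D_v: "(?D ^^ m) (v i) s = (if i = 0 \<and> m = 0 then 2 else 0)
      - (if 1 \<le> i \<and> i \<le> g then (?D ^^ m) (u i) s else 0)"
    if "s \<in> \<Omega>" for m i s
    using that by (auto simp: v_def D_pow_const coord_deriv_pow_uminus[OF dom that smooth])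
  have v_nth: "fls_nth (2 - \<uu> s) (int i) = v i s" if "s \<in> \<Omega>" for i s
    using D_v[OF that, of 0 i] by (simp add: \<uu>_def gen_nth)
  have v1_nth: "fls_nth (\<uu>1 s) (int i) = - ?D (v i) s" if "s \<in> \<Omega>" for i s
    using D_v[OF that, of 1 i] by (simp add: \<uu>1_def gen_nth pd_1)
  have v3_nth: "fls_nth (\<uu>3 s) (int i) = - (?D ^^ 3) (v i) s" if "s \<in> \<Omega>" for i s
    using D_v[OF that, of 3 i] by (simp add: \<uu>3_def gen_nth pd_1)

  interpret kdv: stationary_recursion \<Omega> x g "u 1" v
  proof
    show "smooth_on \<Omega> (u 1)" using \<open>g \<noteq> 0\<close> by (intro smooth) auto
    fix i s assume "i \<le> g" and s: "s \<in> \<Omega>"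
    have "\<uu>3 s + 2 * (fls_const (?D (u 1) s) * (2 - \<uu> s))
        - 4 * (fls_X_inv * \<uu>1 s + fls_const (u 1 s) * \<uu>1 s) = 0"
      using stationary[OF s] unfolding pd_1 by (simp only: mult.assoc distrib_right)
    \<comment> \<open>The factor \<open>fls_X_inv\<close> shifts the index by one, which is how
      \<open>Suc i\<close> enters the recursion.\<close>
    moreover have "fls_nth (P + 2 * (fls_const c * V) - 4 * (fls_X_inv * Q + fls_const d * Q)) (int i)
        = fls_nth P (int i) + 2 * (c * fls_nth V (int i))
          - 4 * (fls_nth Q (int (Suc i)) + d * fls_nth Q (int i))" for P V Q :: "'k fls" and c d
      by (simp add: fls_X_inv_times_conv_shift add.commute)
    ultimately have "fls_nth (\<uu>3 s) (int i) + 2 * (?D (u 1) s * fls_nth (2 - \<uu> s) (int i))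
        - 4 * (fls_nth (\<uu>1 s) (int (Suc i)) + u 1 s * fls_nth (\<uu>1 s) (int i)) = 0"
      by (metis fls_zero_nth)
    then show "4 * ?D (v (Suc i)) s = (?D ^^ 3) (v i) s - 2 * ?D (u 1) s * v i s - 4 * u 1 s * ?D (v i) s"
      unfolding v_nth[OF s] v1_nth[OF s] v3_nth[OF s] by (simp add: algebra_simps)
  qed (use dom v_smooth in \<open>auto simp: v_def\<close>)

  have L_eq: "L = kdv.L"
    unfolding L_def L_op_def pd_1 kdv.L_def by (auto simp: fun_eq_iff mult_op_def numeral_2_eq_2)

  have flow_1: "coord_deriv (e k) (u 1) s = ?D (u k) s" if k: "k \<in> {1..g}" and s: "s \<in> \<Omega>" for k s
  proof -
    define a where "a i = fls_nth (2 - \<uu> s) (int i)" for i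
    define b where "b i = fls_nth (\<uu>1 s) (int i)" for i
    have "pd g e k (u 1) s = fls_nth (gen g (\<lambda>i. pd g e k (u i)) s) 1"
      using k by (simp add: gen_nth)
    also have "\<dots> = 1/2 * ((\<Sum>j<k. a j * b (k - j)) - (\<Sum>j<k. b j * a (k - j)))"
      unfolding flows[OF k s] a_def b_def
      by (subst fls_minus_nth) (simp only: D_trunc_times_nth_1 right_diff_distrib[of "1/2 :: 'k"])
    \<comment> \<open>\<open>a 0 = 2\<close> and \<open>b 0 = 0\<close>, since \<open>\<uu>\<close>
      starts in degree 1; hence only \<open>b k\<close> survives.\<close>
    also have "\<dots> = ?D (u k) s"
      unfolding sum_convolution_commute_diff
      using k by (simp add: a_def b_def \<uu>_def \<uu>1_def gen_nth pd_1)
    finally show ?thesis using k by (simp add: pd_def)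
  qed

  \<comment> \<open>Expanding \<open>pd g e i (L h)\<close> subtracts all of
    \<open>?d (u 1) s * h s\<close>, while \<open>U i\<close> subtracts only half of it. The missing
    half equals 1/2 of \<open>?D (u i) s * h s\<close> by \<open>flow_1\<close>; with the -1/4 from
    the last bracket it gives the +1/4 in \<open>kdv.A i\<close>.\<close>
  have U_eq: "U i h s = pd g e i (L h) s - pd g e (Suc i) h s + kdv.A i h s"
    if i: "i \<in> {1..g}" and h: "smooth_on \<Omega> h" and s: "s \<in> \<Omega>" for i h s
  proof -
    let ?d = "coord_deriv (e i)"
    have pd_i: "pd g e i = ?d" using i by (simp add: pd_def)
    have u: "smooth_on \<Omega> (u i)" "smooth_on \<Omega> (u (Suc 0))"
      using i by (auto intro: smooth)
    \<comment> \<open>\<open>?d\<close> passes one \<open>?D\<close> at a time; this first exchange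
      happens under the outer \<open>?D\<close>.\<close>
    have "?D (?D (?d h)) s = ?D (?d (?D h)) s"
      by (intro coord_deriv_cong[OF dom s] coord_deriv_commute[OF dom] h)
    also have "\<dots> = ?d (?D (?D h)) s"
      by (intro coord_deriv_commute[OF dom] smooth_on_coord_deriv h s)
    finally have commute: "?D (?D (?d h)) s = ?d (?D (?D h)) s" .
    have d_L: "?d (kdv.L h) s = ?d (?D (?D h)) s - (?d (u 1) s * h s + u 1 s * ?d h s)"
      unfolding kdv.L_def by (rule coord_derivI)
        (auto intro!: derivative_eq_intros has_coord_deriv smooth_on_coord_deriv h u s)
    have d_u1: "?d (\<lambda>s. u 1 s * h s) s = ?d (u 1) s * h s + u 1 s * ?d h s"
      by (rule coord_derivI) (auto intro!: derivative_eq_intros has_coord_deriv h u s)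
    have D_ui: "?D (\<lambda>s. u i s * h s) s = ?D (u i) s * h s + u i s * ?D h s"
      by (rule coord_derivI) (auto intro!: derivative_eq_intros has_coord_deriv h u s)
    have "v i s = - u i s" "?D (v i) s = - ?D (u i) s"
      using D_v[OF s, of 0 i] D_v[OF s, of 1 i] i by auto
    then have A: "kdv.A i h s = 1/4 * (?D (u i) s * h s) - 1/2 * (u i s * ?D h s)"
      by (simp add: kdv.A_def)
    have U_i: "U i h s = ?D (?D (?d h)) s
        - 1/2 * (u 1 s * ?d h s + ?d (\<lambda>s. u 1 s * h s) s)
        - 1/4 * (u i s * ?D h s + ?D (\<lambda>s. u i s * h s) s) - pd g e (Suc i) h s"
      by (simp add: U_def U_op_def pd_1 pd_i const_op_def mult_op_def numeral_2_eq_2)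
    show ?thesis
      unfolding U_i L_eq pd_i A d_L d_u1 D_ui commute flow_1[OF i s] by (simp add: field_simps)
  qed

  define T where "T = (\<Sum>i=1..g. U i \<circ> L ^^ (g - i))"
  have T_eq: "T h s = kdv.W h s" if h: "smooth_on \<Omega> h" and s: "s \<in> \<Omega>" for h s
  proof -
    have L_pow: "smooth_on \<Omega> ((L ^^ n) h)" for n
      unfolding L_eq by (rule kdv.smooth_L_pow[OF h])
    \<comment> \<open>\<open>d (Suc i)\<close> carries \<open>L ^^ (g - i)\<close>, so the i-th
      summand of \<open>T\<close> contributes \<open>d i - d (Suc i)\<close> besides its
      \<open>kdv.A\<close> term.\<close>
    define d where "d i = pd g e i ((L ^^ (Suc g - i)) h) s" for i
    have "T h s = (\<Sum>i=1..g. (d i - d (Suc i)) + kdv.A i ((L ^^ (g - i)) h) s)"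
      unfolding T_def sum_oper_apply
      by (intro sum.cong refl) (auto simp: d_def U_eq[OF _ L_pow s] Suc_diff_le)
    also have "\<dots> = (d 1 - d (Suc g)) + (\<Sum>i=1..g. kdv.A i ((L ^^ (g - i)) h) s)"
      unfolding sum.distrib using \<open>g \<noteq> 0\<close> sum_Suc_diff'[of 1 "Suc g" "\<lambda>i. - d i"]
      by (simp add: atLeastLessThanSuc_atLeastAtMost)
    \<comment> \<open>The upper end vanishes by the convention in \<open>pd\<close>.\<close>
    also have "d (Suc g) = 0" by (simp add: d_def pd_def)
    \<comment> \<open>The lower end is the summand of \<open>kdv.W\<close> at index 0:
      \<open>v 0 = 2\<close> makes \<open>kdv.A 0\<close> the derivative in
      \<open>x\<close>.\<close>
    also have "d 1 - 0 = kdv.A 0 ((L ^^ g) h) s"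
      using D_v[OF s, of 0 0] D_v[OF s, of 1 0] by (simp add: d_def pd_1 kdv.A_def)
    finally show ?thesis
      unfolding kdv.W_def L_eq by (simp add: sum.atMost_shift sum.atLeast1_atMost_eq)
  qed
  have T_T: "T (T f) t = kdv.W (kdv.W f) t"
  proof -
    \<comment> \<open>\<open>T f\<close> is known to equal \<open>kdv.W f\<close> on
      \<open>\<Omega>\<close> only, so its smoothness is transported before \<open>T_eq\<close> is
      applied a second time.\<close>
    have "smooth_on \<Omega> (T f)"
      using smooth_on_cong[OF dom kdv.smooth_W[OF f]] T_eq[OF f] by metis
    then have "T (T f) t = kdv.W (T f) t" using t by (rule T_eq)
    also have "\<dots> = kdv.W (kdv.W f) t" using T_eq[OF f] t by (rule kdv.W_cong)
    finally show ?thesis .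
  qed

  define pol where "pol a = (\<Sum>i\<le>g. fls_const (a i) * fls_X ^ i)" for a :: "nat \<Rightarrow> 'k"
  have pol_nth: "fls_nth (pol a) n = (if 0 \<le> n \<and> n \<le> int g then a (nat n) else 0)" for a n
    unfolding pol_def by (subst fls_nth_polynomial) auto
  have pol_v: "2 - \<uu> t = pol (\<lambda>i. v i t)"
  proof (rule fls_eqI)
    fix n show "fls_nth (2 - \<uu> t) n = fls_nth (pol (\<lambda>i. v i t)) n"
      using D_v[OF t, of 0 "nat n"] by (auto simp: pol_nth \<uu>_def gen_nth)
  qed
  have pol_v1: "\<uu>1 t = - pol (\<lambda>i. ?D (v i) t)"
  proof (rule fls_eqI)
    fix n show "fls_nth (\<uu>1 t) n = fls_nth (- pol (\<lambda>i. ?D (v i) t)) n"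
      using D_v[OF t, of 1 "nat n"] by (auto simp: pol_nth \<uu>1_def gen_nth pd_1)
  qed
  have pol_v2: "\<uu>2 t = - pol (\<lambda>i. ?D (?D (v i)) t)"
  proof (rule fls_eqI)
    fix n show "fls_nth (\<uu>2 t) n = fls_nth (- pol (\<lambda>i. ?D (?D (v i)) t)) n"
      using D_v[OF t, of 2 "nat n"] by (auto simp: pol_nth \<uu>2_def gen_nth pd_1 numeral_2_eq_2)
  qed
  \<comment> \<open>The sign in \<open>pol_v1\<close> disappears in the square, and the one in
    \<open>pol_v2\<close> turns the middle term negative.\<close>
  have "4 * (4 * fls_X_inv + (\<Sum>i=1..2*g. fls_const (\<mu> i) * fls_X ^ i))
      = (pol (\<lambda>i. ?D (v i) t))\<^sup>2 - 2 * pol (\<lambda>i. ?D (?D (v i)) t) * pol (\<lambda>i. v i t)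
        + 4 * (fls_X_inv + fls_const (u 1 t)) * (pol (\<lambda>i. v i t))\<^sup>2"
    using mu[OF t] unfolding pol_v pol_v1 pol_v2 by simp
  then have "4 * kdv.W (kdv.W f) t
      = 4 * (kdv.L ^^ (2 * g + 1)) f t + (\<Sum>i=1..2*g. \<mu> i * (kdv.L ^^ (2 * g - i)) f t)"
    unfolding pol_def by (rule kdv.W_W_eq[OF f t])
  then have "4 * T (T f) t = 4 * (L ^^ (2 * g + 1)) f t + (\<Sum>i=1..2*g. \<mu> i * (L ^^ (2 * g - i)) f t)"
    unfolding T_T L_eq .
  then show "(const_op 4 \<circ> (\<Sum>i=1..g. U i \<circ> L ^^ (g - i)) ^^ 2) f t
      = ((const_op 4 \<circ> L ^^ (2*g + 1)) + (\<Sum>i=1..2*g. const_op (\<mu> i) \<circ> L ^^ (2*g - i))) f t"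
    unfolding T_def[symmetric]
    by (simp add: sum_oper_apply const_op_def mult_op_def numeral_2_eq_2)
qed

end
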